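(* Let $n\ge1$, let $K_0\subset\cdots\subset K_n$ be a tower of subfields (equalities allowed) of a finite field $K=\mathbb{F}_q$, let $d_i=|K_i|$, and let $\mathcal{X}=[K_0\times\cdots\times K_n]\subset\mathbb{P}^n$. Let $P=(a_0:\cdots:a_n)\in\mathcal{X}$ and let $j\in\{0,\ldots,n\}$ be the least integer such that $a_j\ne0$. For $j\in\{2,\ldots,n\}$ let $m_j$ be the least integer such that $m_j(d_j-1)>\sum_{i=1}^{j-1}(d_i-1)$. Then $P$ admits an indicator function of degree $1+\sum_{i=1}^n(d_i-1)$ if $j=0$ or $j=1$, and of degree $m_j(d_j-1)+1+\sum_{i=j+1}^n(d_i-1)$ if $j\ge2$ (the last sum being disregarded when $j=n$). Assuming $a_j=1$, an indicator function of this degree is $$f=t_0\prod_{i=1}^n\ \prod_{\lambda\in K_i\setminus\{a_i\}}(t_i-\lambda t_0)\quad\text{if } j=0;$$ $$f=t_1(t_1^{d_1-1}-t_0^{d_1-1})\prod_{i=2}^n\ \prod_{\lambda\in K_i\setminus\{a_i\}}(t_i-\lambda t_1)\quad\text{if } j=1;$$ $$f=t_j(f_1-f_2)\prod_{\ell=j+1}^n\ \prod_{\lambda\in K_\ell\setminus\{a_\ell\}}(t_\ell-\lambda t_j)\quad\text{if } j\ge2,$$ where $$f_1=t_j^{m_j(d_j-1)}-\sum_{i=1}^{j-1}t_i^{m_j(d_j-1)}+\sum_{s=2}^{j-1}\ \sum_{1\le j_1<\cdots<j_s\le j-1}(-1)^s\,t_{j_1}^{m_j(d_j-1)-\sum_{i=2}^s(d_{j_i}-1)}\,t_{j_2}^{d_{j_2}-1}\cdots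 t_{j_s}^{d_{j_s}-1}$$ and $$f_2=t_0^{m_j(d_j-1)-\sum_{i=1}^{j-1}(d_i-1)}\prod_{i=1}^{j-1}(t_0^{d_i-1}-t_i^{d_i-1})$$ (if $j=n$, then $f=t_n(f_1-f_2)$).
   Context: $S=K[t_0,\ldots,t_n]$ with the standard grading, and $\mathbb{P}^n$ is projective space over $K$. $\mathcal{X}=[K_0\times\cdots\times K_n]:=\{(a_0:\cdots:a_n)\in\mathbb{P}^n: a_i\in K_i\text{ for all }i\}$; representatives $(a_0,\ldots,a_n)$ of points of $\mathcal{X}$ are taken with $a_i\in K_i$. An indicator function for $P\in\mathcal{X}$ is a homogeneous polynomial $f\in S$ with $f(P)\ne0$ and $f(Q)=0$ for all $Q\in\mathcal{X}\setminus\{P\}$. Empty sums are $0$ and empty products are $1$. *)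

theory Defs
  imports "HOL-Library.Poly_Mapping"
begin

text \<open>
  Polynomials are finitely supported functions from exponent vectors (themselves finitely
  supported) to coefficients, with the convolution product of the library. The type has
  variables \<open>t\<^sub>0, t\<^sub>1, \<dots>\<close>; the ring \<open>K[t\<^sub>0, \<dots>, t\<^sub>n]\<close> is carved out by \<open>poly_ring n\<close>.
\<close>

type_synonym 'k mpolynomial = "(nat \<Rightarrow>\<^sub>0 nat) \<Rightarrow>\<^sub>0 'k"

definition Var :: "nat \<Rightarrow> 'k::{zero,one} mpolynomial" where
  "Var i = Poly_Mapping.single (Poly_Mapping.single i 1) 1"

definition Const :: "'k::zero \<Rightarrow> 'k mpolynomial" where
  "Const c = Poly_Mapping.single 0 c"

definition poly_ring :: "nat \<Rightarrow> 'k::zero mpolynomial set" where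
  "poly_ring n = {f. \<forall>m\<in>Poly_Mapping.keys f. Poly_Mapping.keys m \<subseteq> {0..n}}"

definition monom_degree :: "(nat \<Rightarrow>\<^sub>0 nat) \<Rightarrow> nat" where
  "monom_degree m = (\<Sum>i\<in>Poly_Mapping.keys m. Poly_Mapping.lookup m i)"

definition total_degree :: "'k::zero mpolynomial \<Rightarrow> nat" where
  "total_degree f = Max (insert 0 (monom_degree ` Poly_Mapping.keys f))"

definition homogeneous :: "'k::zero mpolynomial \<Rightarrow> bool" where
  "homogeneous f \<longleftrightarrow> (\<exists>D. \<forall>m\<in>Poly_Mapping.keys f. monom_degree m = D)"

definition eval_at :: "(nat \<Rightarrow> 'k::comm_semiring_1) \<Rightarrow> 'k mpolynomial \<Rightarrow> 'k" where
  "eval_at x f = (\<Sum>m\<in>Poly_Mapping.keys f. Poly_Mapping.lookup f m *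
      (\<Prod>i\<in>Poly_Mapping.keys m. x i ^ Poly_Mapping.lookup m i))"

definition is_subfield :: "'k::field set \<Rightarrow> bool" where
  "is_subfield F \<longleftrightarrow> 0 \<in> F \<and> 1 \<in> F \<and>
     (\<forall>x\<in>F. \<forall>y\<in>F. x + y \<in> F \<and> x * y \<in> F) \<and>
     (\<forall>x\<in>F. - x \<in> F \<and> inverse x \<in> F)"

text \<open>
  A vector in \<open>K\<^bsup>n+1\<^esup>\<close> is a function on the natural numbers that vanishes beyond \<open>n\<close>. Points of
  projective space are the classes of nonzero vectors, so \<open>a \<in> P\<close> says that \<open>a\<close> is a vector of
  homogeneous coordinates of \<open>P\<close>.
\<close>

definition nonzero_vectors :: "nat \<Rightarrow> (nat \<Rightarrow> 'k::field) set" where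
  "nonzero_vectors n = {x. (\<forall>i>n. x i = 0) \<and> (\<exists>i\<le>n. x i \<noteq> 0)}"

definition proportional :: "nat \<Rightarrow> ((nat \<Rightarrow> 'k::field) \<times> (nat \<Rightarrow> 'k)) set" where
  "proportional n = {(x, y). x \<in> nonzero_vectors n \<and> y \<in> nonzero_vectors n \<and>
     (\<exists>c. c \<noteq> 0 \<and> y = (\<lambda>i. c * x i))}"

definition proj_space :: "nat \<Rightarrow> (nat \<Rightarrow> 'k::field) set set" where
  "proj_space n = nonzero_vectors n // proportional n"

definition proj_grid :: "nat \<Rightarrow> (nat \<Rightarrow> 'k::field set) \<Rightarrow> (nat \<Rightarrow> 'k) set set" where
  "proj_grid n K = {P \<in> proj_space n. \<exists>x\<in>P. \<forall>i\<le>n. x i \<in> K i}"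

text \<open>
  For homogeneous \<open>f\<close>, whether \<open>f\<close> vanishes does not depend on the coordinate vector, so the
  quantifiers over coordinate vectors only express \<open>f(P) \<noteq> 0\<close> and \<open>f(Q) = 0\<close>.
\<close>

definition indicator_function ::
  "nat \<Rightarrow> (nat \<Rightarrow> 'k::field set) \<Rightarrow> (nat \<Rightarrow> 'k) set \<Rightarrow> 'k mpolynomial \<Rightarrow> bool" where
  "indicator_function n K P f \<longleftrightarrow> f \<in> poly_ring n \<and> homogeneous f \<and>
     (\<forall>x\<in>P. eval_at x f \<noteq> 0) \<and>
     (\<forall>Q\<in>proj_grid n K - {P}. \<forall>x\<in>Q. eval_at x f = 0)"

text \<open>
  All \<open>d i\<close> are cardinalities of fields, hence at least 2. The defining inequality has a
  nonnegative left-hand side, so the least integer satisfying it is the least natural number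
  satisfying it.
\<close>

definition least_mult :: "(nat \<Rightarrow> nat) \<Rightarrow> nat \<Rightarrow> nat" where
  "least_mult d j = (LEAST m. (\<Sum>i=1..j-1. d i - 1) < m * (d j - 1))"

text \<open>
  The indices \<open>j\<^sub>1 < \<dots> < j\<^sub>s\<close> are encoded by the set \<open>J = {j\<^sub>1, \<dots>, j\<^sub>s}\<close>, so \<open>j\<^sub>1 = Min J\<close>.
  For \<open>m = least_mult d j\<close> none of the exponents below is truncated by natural subtraction.
\<close>

definition f1_poly :: "(nat \<Rightarrow> nat) \<Rightarrow> nat \<Rightarrow> nat \<Rightarrow> 'k::comm_ring_1 mpolynomial" where
  "f1_poly d j m =
     Var j ^ (m * (d j - 1)) - (\<Sum>i=1..j-1. Var i ^ (m * (d j - 1)))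
     + (\<Sum>s=2..j-1. \<Sum>J | J \<subseteq> {1..j-1} \<and> card J = s.
          (- 1) ^ s * Var (Min J) ^ (m * (d j - 1) - (\<Sum>i\<in>J - {Min J}. d i - 1))
          * (\<Prod>i\<in>J - {Min J}. Var i ^ (d i - 1)))"

definition f2_poly :: "(nat \<Rightarrow> nat) \<Rightarrow> nat \<Rightarrow> nat \<Rightarrow> 'k::comm_ring_1 mpolynomial" where
  "f2_poly d j m =
     Var 0 ^ (m * (d j - 1) - (\<Sum>i=1..j-1. d i - 1))
     * (\<Prod>i=1..j-1. Var 0 ^ (d i - 1) - Var i ^ (d i - 1))"

end

theory Submission
  imports Defs
begin

text \<open>
  In all three cases the polynomial is a product \<open>h T\<close>. On vectors \<open>x\<close> with \<open>x\<^sub>i \<in> K\<^sub>i\<close> the head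
  \<open>h\<close> is nonzero exactly when \<open>j\<close> is the first index with \<open>x\<^sub>j \<noteq> 0\<close>. Then
  \<open>x\<^sub>i / x\<^sub>j \<in> K\<^sub>i\<close> for \<open>i > j\<close>, so the tail \<open>T\<close> is nonzero at \<open>x\<close> only if \<open>x = x\<^sub>j a\<close>. For \<open>j \<ge> 2\<close>,
  Lagrange's theorem in the groups \<open>K\<^sub>i - {0}\<close> turns every power in \<open>f\<^sub>1\<close> and \<open>f\<^sub>2\<close> into an
  indicator \<open>u\<^sub>i = [x\<^sub>i \<noteq> 0]\<close>, and by inclusion-exclusion \<open>f\<^sub>1\<close> becomes the product of the
  \<open>1 - u\<^sub>i\<close> with \<open>1 \<le> i < j\<close> while \<open>f\<^sub>2\<close> becomes \<open>u\<^sub>0\<close> times that product.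
\<close>

section \<open>Evaluation\<close>

text \<open>Indices outside the support contribute zeroth powers. A common index set lets monomials
  with different supports be multiplied factor by factor.\<close>

lemma monomial_value_superset:
  fixes x :: "nat \<Rightarrow> 'k::comm_semiring_1"
  assumes "finite S" "Poly_Mapping.keys m \<subseteq> S"
  shows "(\<Prod>i\<in>Poly_Mapping.keys m. x i ^ Poly_Mapping.lookup m i)
       = (\<Prod>i\<in>S. x i ^ Poly_Mapping.lookup m i)"
  using assms by (intro prod.mono_neutral_left) (auto simp: in_keys_iff)

lemma monomial_value_add:
  fixes x :: "nat \<Rightarrow> 'k::comm_semiring_1"
  shows "(\<Prod>i\<in>Poly_Mapping.keys (m + m'). x i ^ Poly_Mapping.lookup (m + m') i)
       = (\<Prod>i\<in>Poly_Mapping.keys m. x i ^ Poly_Mapping.lookup m i)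
         * (\<Prod>i\<in>Poly_Mapping.keys m'. x i ^ Poly_Mapping.lookup m' i)"
proof -
  let ?S = "Poly_Mapping.keys m \<union> Poly_Mapping.keys m'"
  have *: "Poly_Mapping.keys (m + m') \<subseteq> ?S" by (rule keys_add)
  show ?thesis
    by (subst (1 2 3) monomial_value_superset[of ?S]) (use * in \<open>auto simp: lookup_add power_add prod.distrib\<close>)
qed

lemma monom_degree_add: "monom_degree (m + m') = monom_degree m + monom_degree m'"
  unfolding monom_degree_def
  by (rule setsum_keys_plus_distrib) auto

lemma eval_at_zero [simp]: "eval_at x 0 = 0"
  by (simp add: eval_at_def)

lemma eval_at_add [simp]: "eval_at x (f + g) = eval_at x f + eval_at x g"
  unfolding eval_at_def
  by (rule setsum_keys_plus_distrib[where f = "\<lambda>m c. c * (\<Prod>i\<in>Poly_Mapping.keys m. x i ^ Poly_Mapping.lookup m i)"])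
    (auto simp: algebra_simps)

lemma eval_at_single:
  "eval_at x (Poly_Mapping.single m c) = c * (\<Prod>i\<in>Poly_Mapping.keys m. x i ^ Poly_Mapping.lookup m i)"
  by (auto simp: eval_at_def)

text \<open>Updating a coefficient outside the support amounts to adding a single term, so every
  polynomial arises from \<open>0\<close> by adding single terms. With additivity, this reduces
  multiplicativity of evaluation to monomials.\<close>

lemma poly_mapping_add_induct [case_names zero add]:
  fixes f :: "'a \<Rightarrow>\<^sub>0 'b::comm_monoid_add"
  assumes "Q 0" and "\<And>m c g. Q g \<Longrightarrow> Q (Poly_Mapping.single m c + g)"
  shows "Q f"
proof (induction f rule: update_induct)
  case const
  then show ?case by (rule assms)
next
  case (update f m c)
  have "Poly_Mapping.update m c f = Poly_Mapping.single m c + f"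
    using update(1)
    by (intro poly_mapping_eqI) (auto simp: lookup_update lookup_add lookup_single in_keys_iff)
  then show ?case using update assms(2) by simp
qed

lemma eval_at_mult [simp]: "eval_at x (f * g) = eval_at x f * eval_at x g"
proof (induction f rule: poly_mapping_add_induct)
  case (add m c f)
  have "eval_at x (Poly_Mapping.single m c * g) = eval_at x (Poly_Mapping.single m c) * eval_at x g"
    by (induction g rule: poly_mapping_add_induct)
      (simp_all add: mult_single eval_at_single monomial_value_add algebra_simps)
  then show ?case using add by (simp add: algebra_simps)
qed simp

lemma eval_at_Const [simp]: "eval_at x (Const c) = c"
  by (simp add: Const_def eval_at_single)

lemma eval_at_Var [simp]: "eval_at x (Var i) = x i"
  by (simp add: Var_def eval_at_single)

lemma eval_at_one [simp]: "eval_at x 1 = 1"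
  by (metis Const_def eval_at_Const single_one)

lemma eval_at_uminus [simp]:
  fixes x :: "nat \<Rightarrow> 'k::comm_ring_1"
  shows "eval_at x (- f) = - eval_at x f"
  by (metis add.right_inverse eval_at_add eval_at_zero minus_unique)

lemma eval_at_diff [simp]:
  fixes x :: "nat \<Rightarrow> 'k::comm_ring_1"
  shows "eval_at x (f - g) = eval_at x f - eval_at x g"
  by (metis eval_at_add eval_at_uminus uminus_add_conv_diff add.commute)

lemma eval_at_power [simp]: "eval_at x (f ^ k) = eval_at x f ^ k"
  by (induction k) simp_all

lemma eval_at_sum [simp]: "eval_at x (\<Sum>i\<in>A. f i) = (\<Sum>i\<in>A. eval_at x (f i))"
  by (induction A rule: infinite_finite_induct) simp_all

lemma eval_at_prod [simp]: "eval_at x (\<Prod>i\<in>A. f i) = (\<Prod>i\<in>A. eval_at x (f i))"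
  by (induction A rule: infinite_finite_induct) simp_all

section \<open>Forms of a given degree\<close>

text \<open>Membership in \<open>poly_ring n\<close> and homogeneity, with the degree named. The
  zero polynomial is a form of every degree, so forms of one degree are closed under sums and
  differences; \<open>total_degree\<close> is recovered only for nonzero forms.\<close>

definition form :: "nat \<Rightarrow> nat \<Rightarrow> 'k::zero mpolynomial \<Rightarrow> bool" where
  "form n D f \<longleftrightarrow>
     (\<forall>m\<in>Poly_Mapping.keys f. Poly_Mapping.keys m \<subseteq> {0..n} \<and> monom_degree m = D)"

lemma form_zero: "form n D 0"
  by (simp add: form_def)

lemma form_Var: "i \<le> n \<Longrightarrow> form n 1 (Var i :: 'k::zero_neq_one mpolynomial)"
  by (simp add: form_def Var_def monom_degree_def)

lemma form_Const: "form n 0 (Const c)"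
  by (simp add: form_def Const_def monom_degree_def)

lemma form_one: "form n 0 (1 :: 'k::zero_neq_one mpolynomial)"
  by (simp add: form_def monom_degree_def)

lemma form_add: "form n D f \<Longrightarrow> form n D g \<Longrightarrow> form n D (f + g)"
  using keys_add[of f g] unfolding form_def by blast

lemma form_uminus: "form n D f \<Longrightarrow> form n D (- f)"
  for f :: "'k::ab_group_add mpolynomial"
  by (auto simp: form_def in_keys_iff)

lemma form_diff: "form n D f \<Longrightarrow> form n D g \<Longrightarrow> form n D (f - g)"
  for f :: "'k::ab_group_add mpolynomial"
  using form_add[of n D f "- g"] form_uminus[of n D g] by simp

lemma form_mult:
  fixes f g :: "'k::comm_semiring_1 mpolynomial"
  assumes "form n D f" "form n E g"
  shows "form n (D + E) (f * g)"
  unfolding form_def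
proof
  fix m assume "m \<in> Poly_Mapping.keys (f * g)"
  then obtain p q where m: "m = p + q" and "p \<in> Poly_Mapping.keys f" "q \<in> Poly_Mapping.keys g"
    using keys_mult[of f g] by blast
  then have "Poly_Mapping.keys p \<subseteq> {0..n}" "monom_degree p = D"
    "Poly_Mapping.keys q \<subseteq> {0..n}" "monom_degree q = E"
    using assms unfolding form_def by blast+
  then show "Poly_Mapping.keys m \<subseteq> {0..n} \<and> monom_degree m = D + E"
    using keys_add[of p q] by (simp add: m monom_degree_add) blast
qed

lemma form_power:
  fixes f :: "'k::comm_semiring_1 mpolynomial"
  shows "form n D f \<Longrightarrow> form n (k * D) (f ^ k)"
  by (induction k) (auto simp: form_one intro: form_mult)

lemma form_Var_power: "i \<le> n \<Longrightarrow> form n k (Var i ^ k :: 'k::comm_semiring_1 mpolynomial)"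
  using form_power[OF form_Var, of i n k] by simp

lemma form_sum: "(\<And>i. i \<in> A \<Longrightarrow> form n D (f i)) \<Longrightarrow> form n D (\<Sum>i\<in>A. f i)"
  by (induction A rule: infinite_finite_induct) (auto simp: form_zero intro: form_add)

lemma form_prod:
  fixes f :: "'a \<Rightarrow> 'k::comm_semiring_1 mpolynomial"
  shows "(\<And>i. i \<in> A \<Longrightarrow> form n (D i) (f i)) \<Longrightarrow> form n (\<Sum>i\<in>A. D i) (\<Prod>i\<in>A. f i)"
  by (induction A rule: infinite_finite_induct) (auto simp: form_one intro: form_mult)

text \<open>All monomials of a form acquire the same factor \<open>c ^ D\<close>. For nonzero
  \<open>c\<close> this makes vanishing a property of the projective point.\<close>

lemma eval_at_scale:
  fixes x :: "nat \<Rightarrow> 'k::comm_semiring_1"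
  assumes "form n D f"
  shows "eval_at (\<lambda>i. c * x i) f = c ^ D * eval_at x f"
proof -
  have "(\<Prod>i\<in>Poly_Mapping.keys m. (c * x i) ^ Poly_Mapping.lookup m i)
      = c ^ D * (\<Prod>i\<in>Poly_Mapping.keys m. x i ^ Poly_Mapping.lookup m i)"
    if "m \<in> Poly_Mapping.keys f" for m
    using that assms
    by (auto simp: form_def monom_degree_def power_mult_distrib prod.distrib power_sum)
  then show ?thesis
    by (simp add: eval_at_def sum_distrib_left mult.left_commute)
qed

lemma form_imp_poly_ring: "form n D f \<Longrightarrow> f \<in> poly_ring n"
  by (simp add: form_def poly_ring_def)

lemma form_imp_homogeneous: "form n D f \<Longrightarrow> homogeneous f"
  by (auto simp: form_def homogeneous_def)

lemma form_imp_total_degree: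
  assumes "form n D f" "f \<noteq> 0"
  shows "total_degree f = D"
proof -
  have "monom_degree ` Poly_Mapping.keys f = {D}"
    using assms by (auto simp: form_def image_constant_conv)
  then show ?thesis by (simp add: total_degree_def)
qed

section \<open>Subfields of a finite field\<close>

lemma subfield_divide:
  "is_subfield F \<Longrightarrow> x \<in> F \<Longrightarrow> y \<in> F \<Longrightarrow> x / y \<in> F"
  by (simp add: is_subfield_def divide_inverse)

lemma subfield_card_ge_2:
  fixes F :: "'k::{field,finite} set"
  assumes "is_subfield F"
  shows "card F \<ge> 2"
  using card_mono[of F "{0, 1}"] assms by (auto simp: is_subfield_def)

text \<open>Lagrange's theorem for the unit group: multiplication by \<open>x\<close> permutes
  \<open>F - {0}\<close>, so the nonzero product of all its elements is unchanged by the factor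
  \<open>x ^ card (F - {0})\<close>.\<close>

lemma subfield_power_card:
  fixes F :: "'k::{field,finite} set"
  assumes F: "is_subfield F" and x: "x \<in> F" "x \<noteq> 0"
  shows "x ^ (card F - 1) = 1"
proof -
  let ?U = "F - {0}"
  have "bij_betw (\<lambda>y. x * y) ?U ?U"
  proof (rule bij_betw_byWitness[where f' = "\<lambda>y. y / x"])
    show "(\<lambda>y. y / x) ` ?U \<subseteq> ?U"
      using subfield_divide[OF F] x by auto
    show "(\<lambda>y. x * y) ` ?U \<subseteq> ?U"
      using F x by (auto simp: is_subfield_def)
  qed (use x in auto)
  then have "(\<Prod>y\<in>?U. x * y) = (\<Prod>y\<in>?U. y)"
    by (rule prod.reindex_bij_betw)
  then have "x ^ card ?U * (\<Prod>y\<in>?U. y) = (\<Prod>y\<in>?U. y)"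
    by (simp add: prod.distrib)
  moreover have "(\<Prod>y\<in>?U. y) \<noteq> 0" by simp
  moreover have "card ?U = card F - 1"
    using F by (simp add: is_subfield_def)
  ultimately show ?thesis by simp
qed

section \<open>Points\<close>

lemma proportionalI:
  "x \<in> nonzero_vectors n \<Longrightarrow> y \<in> nonzero_vectors n \<Longrightarrow> c \<noteq> 0 \<Longrightarrow> y = (\<lambda>i. c * x i)
    \<Longrightarrow> (x, y) \<in> proportional n"
  unfolding proportional_def by blast

lemma proportionalE:
  assumes "(x, y) \<in> proportional n"
  obtains c where "x \<in> nonzero_vectors n" "y \<in> nonzero_vectors n" "c \<noteq> 0" "y = (\<lambda>i. c * x i)"
  using assms unfolding proportional_def by blast

lemma equiv_proportional:
  "equiv (nonzero_vectors n) (proportional n :: ((nat \<Rightarrow> 'k::field) \<times> (nat \<Rightarrow> 'k)) set)"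
  (is "equiv ?V ?R")
proof (rule equivI)
  show "?R \<subseteq> ?V \<times> ?V"
    by (auto elim: proportionalE)
  show "refl_on ?V (?R)"
    by (auto simp: refl_on_def intro: proportionalI[where c = 1])
  show "sym (?R)"
  proof (rule symI)
    fix x y :: "nat \<Rightarrow> 'k" assume "(x, y) \<in> ?R"
    then obtain c where c: "x \<in> ?V" "y \<in> ?V" "c \<noteq> 0" "y = (\<lambda>i. c * x i)"
      by (rule proportionalE)
    show "(y, x) \<in> ?R"
      by (rule proportionalI[OF c(2,1), where c = "inverse c"]) (use c(3,4) in \<open>simp_all flip: mult.assoc\<close>)
  qed
  show "trans (?R)"
  proof (rule transI)
    fix x y z :: "nat \<Rightarrow> 'k" assume xy: "(x, y) \<in> ?R" and yz: "(y, z) \<in> ?R"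
    obtain c where c: "x \<in> ?V" "c \<noteq> 0" "y = (\<lambda>i. c * x i)"
      using xy by (rule proportionalE)
    obtain c' where c': "z \<in> ?V" "c' \<noteq> 0" "z = (\<lambda>i. c' * y i)"
      using yz by (rule proportionalE)
    show "(x, z) \<in> ?R"
      by (rule proportionalI[OF c(1) c'(1), where c = "c' * c"]) (use c c' in \<open>simp_all add: mult.assoc\<close>)
  qed
qed

lemma proj_space_nonzero_vectors: "P \<in> proj_space n \<Longrightarrow> x \<in> P \<Longrightarrow> x \<in> nonzero_vectors n"
  using in_quotient_imp_subset[OF equiv_proportional] by (auto simp: proj_space_def)

lemma proj_space_eq_iff:
  "P \<in> proj_space n \<Longrightarrow> Q \<in> proj_space n \<Longrightarrow> x \<in> P \<Longrightarrow> y \<in> Q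
    \<Longrightarrow> P = Q \<longleftrightarrow> (x, y) \<in> proportional n"
  unfolding proj_space_def by (rule quotient_eq_iff[OF equiv_proportional])

lemma proj_space_scale:
  assumes "P \<in> proj_space n" "x \<in> P" "c \<noteq> 0"
  shows "(\<lambda>i. c * x i) \<in> P"
proof -
  have "(x, \<lambda>i. c * x i) \<in> proportional n"
    using proj_space_nonzero_vectors[OF assms(1,2)] assms(3)
    by (auto simp: proportional_def nonzero_vectors_def)
  then show ?thesis
    using assms in_quotient_imp_closed[OF equiv_proportional] by (auto simp: proj_space_def)
qed

text \<open>A coordinate vector of a grid point need not have its entries in the sets
  \<open>K i\<close>; this moves a test of vanishing to one that does.\<close>

lemma eval_at_same_point:
  assumes "P \<in> proj_space n" "x \<in> P" "y \<in> P" "form n D f"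
  shows "eval_at x f = 0 \<longleftrightarrow> eval_at y f = 0"
proof -
  have "(x, y) \<in> proportional n"
    using proj_space_eq_iff[of P n P x y] assms by blast
  then obtain c where "c \<noteq> 0" "y = (\<lambda>i. c * x i)"
    by (auto simp: proportional_def)
  then show ?thesis using eval_at_scale[OF assms(4)] by simp
qed

section \<open>Indicator functions from a head\<close>

text \<open>The three cases differ only in the head. In the tail, \<open>c\<close> runs through all
  of \<open>K i\<close> except \<open>a i\<close>, so among the possible ratios of
  \<open>x i\<close> to \<open>x j\<close> only \<open>a i\<close> survives; the omitted value also
  accounts for the \<open>- 1\<close> in the degree.\<close>

lemma indicator_of_head:
  fixes K :: "nat \<Rightarrow> 'k::{field,finite} set"
  assumes subfield: "\<And>i. i \<le> n \<Longrightarrow> is_subfield (K i)"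
    and tower: "\<And>i k. i \<le> k \<Longrightarrow> k \<le> n \<Longrightarrow> K i \<subseteq> K k"
    and P: "P \<in> proj_grid n K" "a \<in> P" "\<And>i. i \<le> n \<Longrightarrow> a i \<in> K i"
    and j: "j \<le> n" "a j = 1" "\<And>i. i < j \<Longrightarrow> a i = 0"
    and h: "form n e h"
    and head: "\<And>x. (\<And>i. i \<le> n \<Longrightarrow> x i \<in> K i) \<Longrightarrow>
      eval_at x h \<noteq> 0 \<longleftrightarrow> x j \<noteq> 0 \<and> (\<forall>i<j. x i = 0)"
    and f: "f = h * (\<Prod>i=j+1..n. \<Prod>c\<in>K i - {a i}. Var i - Const c * Var j)"
  shows "indicator_function n K P f" "total_degree f = e + (\<Sum>i=j+1..n. card (K i) - 1)"
proof -
  let ?D = "e + (\<Sum>i=j+1..n. card (K i) - 1)"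
  have factor: "form n 1 (Var i - Const c * Var j)" if "i \<in> {j+1..n}" for i and c :: 'k
    using that j form_mult[OF form_Const form_Var, of j n c]
    by (intro form_diff form_Var) auto
  have "form n (\<Sum>c\<in>K i - {a i}. 1) (\<Prod>c\<in>K i - {a i}. Var i - Const c * Var j)"
    if "i \<in> {j+1..n}" for i
    using factor[OF that] by (intro form_prod)
  moreover have "(\<Sum>c\<in>K i - {a i}. 1) = card (K i) - 1" if "i \<in> {j+1..n}" for i
    using that P(3) by simp
  ultimately have form: "form n ?D f"
    unfolding f by (intro form_mult h form_prod) (metis)
  have nz_iff: "eval_at x f \<noteq> 0 \<longleftrightarrow> eval_at x h \<noteq> 0 \<and> (\<forall>i\<in>{j+1..n}. \<forall>c\<in>K i - {a i}. x i \<noteq> c * x j)"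
    for x by (simp add: f)
  have "eval_at a f \<noteq> 0"
    unfolding nz_iff using head[of a] P(3) j by auto
  have "P \<in> proj_space n" using P by (simp add: proj_grid_def)
  \<comment> \<open>The multiple of \<open>a\<close> has to be by \<open>y j\<close> because
    \<open>a j = 1\<close>.\<close>
  have "y = (\<lambda>i. y j * a i)"
    if y: "y \<in> nonzero_vectors n" "\<And>i. i \<le> n \<Longrightarrow> y i \<in> K i" "eval_at y f \<noteq> 0" for y
  proof
    fix i
    have yj: "y j \<noteq> 0" and low: "\<And>i. i < j \<Longrightarrow> y i = 0"
      and nz: "\<And>i c. i \<in> {j+1..n} \<Longrightarrow> c \<in> K i - {a i} \<Longrightarrow> y i \<noteq> c * y j"
      using y(3) head[of y] y(2) unfolding nz_iff by auto
    consider "i < j" | "i = j" | "j < i" "i \<le> n" | "n < i" by linarith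
    then show "y i = y j * a i"
    proof cases
      case 3
      \<comment> \<open>The tower puts \<open>y j\<close>, an element of \<open>K j\<close>, into
        \<open>K i\<close>. A ratio other than \<open>a i\<close> would thus be one of the values
        \<open>c\<close> at which the tail vanishes.\<close>
      then have "y i / y j \<in> K i"
        using subfield_divide[OF subfield, of i "y i" "y j"] y(2)[of i] y(2)[of j] tower[of j i] j by auto
      then show ?thesis using nz[of i "y i / y j"] 3 yj by (force simp: field_simps)
    next
      case 4
      then show ?thesis
        using y(1) proj_space_nonzero_vectors[OF \<open>P \<in> proj_space n\<close> P(2)]
        by (simp add: nonzero_vectors_def)
    qed (use low j in auto)
  qed
  note eq = this
  have "eval_at x f = 0" if Q: "Q \<in> proj_grid n K - {P}" "x \<in> Q" for Q x
  proof (rule ccontr)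
    assume nz: "eval_at x f \<noteq> 0"
    \<comment> \<open>The vector \<open>x\<close> is an arbitrary representative of
      \<open>Q\<close>, whereas the head is controlled only on vectors with entries in the
      \<open>K i\<close>; hence the passage to such a representative \<open>y\<close>.\<close>
    obtain y where y: "y \<in> Q" "\<And>i. i \<le> n \<Longrightarrow> y i \<in> K i" and QS: "Q \<in> proj_space n"
      using Q by (auto simp: proj_grid_def)
    have yV: "y \<in> nonzero_vectors n" using proj_space_nonzero_vectors[OF QS y(1)] .
    have ynz: "eval_at y f \<noteq> 0"
      using nz eval_at_same_point[OF QS Q(2) y(1) form] by simp
    have "y j \<noteq> 0" using head[of y] y(2) ynz unfolding nz_iff by auto
    then have "y \<in> P"
      using proj_space_scale[OF \<open>P \<in> proj_space n\<close> P(2)] eq[OF yV _ ynz] y(2) by metis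
    then have "P = Q"
      using y(1) quotient_disj[OF equiv_proportional] \<open>P \<in> proj_space n\<close> QS
      unfolding proj_space_def by blast
    then show False using Q by simp
  qed
  moreover have "eval_at x f \<noteq> 0" if "x \<in> P" for x
    using eval_at_same_point[OF \<open>P \<in> proj_space n\<close> that P(2) form] \<open>eval_at a f \<noteq> 0\<close> by simp
  ultimately show "indicator_function n K P f"
    using form_imp_poly_ring[OF form] form_imp_homogeneous[OF form]
    by (simp add: indicator_function_def)
  have "f \<noteq> 0" using \<open>eval_at a f \<noteq> 0\<close> by auto
  then show "total_degree f = ?D" by (rule form_imp_total_degree[OF form])
qed

section \<open>The head for a leading index at least 2\<close>

lemma least_mult_greater:
  assumes "d j \<ge> 2"
  shows "(\<Sum>i=1..j-1. d i - 1) < least_mult d j * (d j - 1)"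
  unfolding least_mult_def
proof (rule LeastI)
  \<comment> \<open>One more than the sum itself serves as a witness for the minimum, since
    \<open>d j - 1\<close> is at least 1.\<close>
  have "s < Suc s * (d j - 1)" for s
    using assms by (cases "d j - 1") auto
  then show "(\<Sum>i=1..j-1. d i - 1) < Suc (\<Sum>i=1..j-1. d i - 1) * (d j - 1)"
    .
qed

text \<open>Inclusion-exclusion, with the subsets of \<open>A\<close> grouped by size and the sizes
  0 and 1 split off, to match the shape of \<open>f1_poly\<close>.\<close>

lemma prod_one_minus_by_card:
  fixes u :: "'a \<Rightarrow> 'b::comm_ring_1"
  assumes A: "finite A" "card A \<ge> 1"
  shows "(\<Prod>i\<in>A. 1 - u i)
    = 1 - (\<Sum>i\<in>A. u i) + (\<Sum>s=2..card A. \<Sum>J | J \<subseteq> A \<and> card J = s. (- 1) ^ s * (\<Prod>i\<in>J. u i))"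
proof -
  define g where "g = (\<lambda>s. \<Sum>J | J \<subseteq> A \<and> card J = s. (- 1) ^ s * (\<Prod>i\<in>J. u i))"
  have "(\<Prod>i\<in>A. 1 - u i) = (\<Sum>J\<in>Pow A. (- 1) ^ card J * (\<Prod>i\<in>J. u i))"
    using prod_diff_conv_sum[OF A(1), of "\<lambda>_. 1" u] by simp
  also have "\<dots> = (\<Sum>s\<in>{..card A}. \<Sum>J | J \<in> Pow A \<and> card J = s. (- 1) ^ card J * (\<Prod>i\<in>J. u i))"
    using A by (intro sum.group[symmetric]) (auto intro: card_mono)
  also have "\<dots> = (\<Sum>s\<in>{..card A}. g s)"
    unfolding g_def by (intro sum.cong) auto
  \<comment> \<open>Size 1 occurs because \<open>A\<close> is nonempty; when
    \<open>card A = 1\<close> the remaining range is empty.\<close>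
  also have "{..card A} = {0, 1} \<union> {2..card A}" using A by auto
  also have "(\<Sum>s\<in>\<dots>. g s) = g 0 + g 1 + (\<Sum>s=2..card A. g s)"
    by (subst sum.union_disjoint) auto
  also have "{J. J \<subseteq> A \<and> card J = 0} = {{}}"
    using A by (auto dest: finite_subset)
  then have "g 0 = 1" by (simp add: g_def)
  also have "{J. J \<subseteq> A \<and> card J = 1} = (\<lambda>i. {i}) ` A"
    by (auto simp: card_1_singleton_iff)
  then have "g 1 = - (\<Sum>i\<in>A. u i)"
    by (simp add: g_def sum.reindex sum_negf)
  finally show ?thesis by (simp add: g_def)
qed

text \<open>The setting for a leading index \<open>j\<close> of at least 2. Here \<open>m\<close> is
  the single number belonging to \<open>j\<close>, not the family of all these numbers.\<close>

locale subfield_tower =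
  fixes n j :: nat and K :: "nat \<Rightarrow> 'k::{field,finite} set" and d :: "nat \<Rightarrow> nat" and m :: nat
  assumes subfield: "\<And>i. i \<le> n \<Longrightarrow> is_subfield (K i)"
    and tower: "\<And>i k. i \<le> k \<Longrightarrow> k \<le> n \<Longrightarrow> K i \<subseteq> K k"
    and d: "\<And>i. i \<le> n \<Longrightarrow> d i = card (K i)"
    and j: "2 \<le> j" "j \<le> n"
    and m: "m = least_mult d j"
begin

lemma d_ge_2: "i \<le> n \<Longrightarrow> d i \<ge> 2"
  using subfield_card_ge_2[OF subfield] d by simp

lemma sum_less: "(\<Sum>i=1..j-1. d i - 1) < m * (d j - 1)"
  unfolding m using d_ge_2 j by (intro least_mult_greater)

text \<open>Rules out truncation in the exponents of \<open>f1_poly\<close>. Strictness also keeps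
  them positive, which matters when the base is 0.\<close>

lemma sum_subset_less:
  assumes "J \<subseteq> {1..j-1}"
  shows "(\<Sum>i\<in>J. d i - 1) < m * (d j - 1)"
  using sum_mono2[OF _ assms, of "\<lambda>i. d i - 1"] sum_less by simp

lemma Min_index:
  assumes "s \<ge> 2" "J \<subseteq> {1..j-1}" "card J = s"
  shows "finite J" "Min J \<in> J" "J - {Min J} \<subseteq> {1..j-1}"
proof -
  show "finite J" using assms(2) finite_subset by blast
  then show "Min J \<in> J" using assms by (intro Min_in) auto
  show "J - {Min J} \<subseteq> {1..j-1}" using assms by blast
qed

lemma form_f1: "form n (m * (d j - 1)) (f1_poly d j m :: 'k mpolynomial)"
proof -
  have "form n (m * (d j - 1)) ((- 1) ^ s * Var (Min J) ^ (m * (d j - 1) - (\<Sum>i\<in>J - {Min J}. d i - 1))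
          * (\<Prod>i\<in>J - {Min J}. Var i ^ (d i - 1)) :: 'k mpolynomial)"
    if s: "s \<ge> 2" "J \<subseteq> {1..j-1}" "card J = s" for s J
  proof -
    have "form n (s * 0) ((- 1) ^ s :: 'k mpolynomial)"
      by (intro form_power form_uminus form_one)
    moreover have "Min J \<le> n" using subsetD[OF s(2) Min_index(2)[OF s]] j by force
    moreover have "form n (\<Sum>i\<in>J - {Min J}. d i - 1) (\<Prod>i\<in>J - {Min J}. Var i ^ (d i - 1) :: 'k mpolynomial)"
      using subsetD[OF s(2)] j by (intro form_prod form_Var_power) force
    ultimately have "form n (s * 0 + (m * (d j - 1) - (\<Sum>i\<in>J - {Min J}. d i - 1)) + (\<Sum>i\<in>J - {Min J}. d i - 1))
       ((- 1) ^ s * Var (Min J) ^ (m * (d j - 1) - (\<Sum>i\<in>J - {Min J}. d i - 1))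
          * (\<Prod>i\<in>J - {Min J}. Var i ^ (d i - 1)) :: 'k mpolynomial)"
      by (intro form_mult form_Var_power)
    \<comment> \<open>The subtraction is exact, so the exponent of the smallest index fills the
      degree up to \<open>m * (d j - 1)\<close>.\<close>
    then show ?thesis using sum_subset_less[OF Min_index(3)[OF s]] by simp
  qed
  then show ?thesis
    unfolding f1_poly_def using j
    by (intro form_add form_diff form_sum form_Var_power) auto
qed

lemma form_f2: "form n (m * (d j - 1)) (f2_poly d j m :: 'k mpolynomial)"
proof -
  have "form n ((m * (d j - 1) - (\<Sum>i=1..j-1. d i - 1)) + (\<Sum>i=1..j-1. d i - 1))
      (f2_poly d j m :: 'k mpolynomial)"
    unfolding f2_poly_def using j
    by (intro form_mult form_prod form_diff form_Var_power) auto
  then show ?thesis using sum_less by simp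
qed

section \<open>Values of \<open>f1_poly\<close> and \<open>f2_poly\<close> at vectors with entries
  in the tower\<close>

context
  fixes x :: "nat \<Rightarrow> 'k"
  assumes x: "\<And>i. i \<le> n \<Longrightarrow> x i \<in> K i"
begin

text \<open>For \<open>i \<le> k\<close> the entry \<open>x i\<close> lies in \<open>K k\<close> by
  the tower, so Lagrange's theorem applies in the larger field.\<close>

lemma coord_power_card:
  assumes "i \<le> k" "k \<le> n" "x i \<noteq> 0"
  shows "x i ^ (d k - 1) = 1"
  using assms x[of i] subfield_power_card[OF subfield, of k "x i"] tower[of i k] d[of k] by auto

lemma coord_power_mult:
  assumes "i \<le> j" "x i \<noteq> 0"
  shows "x i ^ (m * (d j - 1)) = 1"
  using coord_power_card[of i j] assms j by (simp add: power_mult mult.commute[of m])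

text \<open>Both the full power and the subtracted power of \<open>x i\<close> are 1, hence so is
  their quotient. The subtracted one needs \<open>i\<close> below all of \<open>J\<close>, which is
  why the smallest index carries the complementary exponent.\<close>

lemma coord_power_rest:
  assumes "J \<subseteq> {1..j-1}" "x i \<noteq> 0" "i \<le> j" "\<And>k. k \<in> J \<Longrightarrow> i \<le> k"
  shows "x i ^ (m * (d j - 1) - (\<Sum>k\<in>J. d k - 1)) = 1"
proof -
  have "x i ^ (\<Sum>k\<in>J. d k - 1) = 1"
    unfolding power_sum using assms(2,4) subsetD[OF assms(1)] j
    by (intro prod.neutral ballI coord_power_card) force+
  moreover have "x i ^ (m * (d j - 1))
      = x i ^ (m * (d j - 1) - (\<Sum>k\<in>J. d k - 1)) * x i ^ (\<Sum>k\<in>J. d k - 1)"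
    using sum_subset_less[OF assms(1)] by (simp flip: power_add)
  ultimately show ?thesis using coord_power_mult assms by simp
qed

abbreviation nz :: "nat \<Rightarrow> 'k" where
  "nz i \<equiv> of_bool (x i \<noteq> 0)"

text \<open>Lagrange's theorem covers nonzero entries. At a zero entry the exponents must be
  positive, which follows from \<open>d i \<ge> 2\<close> and \<open>sum_less\<close>.\<close>

lemma coord_power_nz:
  assumes "1 \<le> i" "i < j"
  shows "x i ^ (d i - 1) = nz i" "x i ^ (m * (d j - 1)) = nz i"
proof -
  have "d i \<ge> 2" using d_ge_2 assms j by simp
  then show "x i ^ (d i - 1) = nz i"
    using coord_power_card[of i i] assms j by auto
  have "0 < m * (d j - 1)" using sum_less by linarith
  then show "x i ^ (m * (d j - 1)) = nz i"
    using coord_power_mult[of i] assms by (cases "x i = 0") (auto simp: power_0_left)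
qed

text \<open>The summand for \<open>J\<close> becomes the product of \<open>nz i\<close> over
  \<open>J\<close> up to sign, whatever exponents its variables carry, so inclusion-exclusion
  applies. The assumption on \<open>x j\<close> turns the leading power into the constant term
  1.\<close>

lemma eval_f1:
  assumes "x j \<noteq> 0"
  shows "eval_at x (f1_poly d j m) = (\<Prod>i=1..j-1. 1 - nz i)"
proof -
  have term_eq: "x (Min J) ^ (m * (d j - 1) - (\<Sum>i\<in>J - {Min J}. d i - 1))
      * (\<Prod>i\<in>J - {Min J}. x i ^ (d i - 1)) = (\<Prod>i\<in>J. nz i)"
    if s: "s \<ge> 2" "J \<subseteq> {1..j-1}" "card J = s" for s J
  proof -
    note J = Min_index[OF s]
    have "x (Min J) ^ (m * (d j - 1) - (\<Sum>i\<in>J - {Min J}. d i - 1)) = nz (Min J)"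
    proof (cases "x (Min J) = 0")
      case True
      then show ?thesis using sum_subset_less[OF J(3)] by simp
    next
      case False
      moreover have "Min J \<le> j" using subsetD[OF s(2) J(2)] by force
      ultimately show ?thesis using J by (subst coord_power_rest) auto
    qed
    moreover have "(\<Prod>i\<in>J - {Min J}. x i ^ (d i - 1)) = (\<Prod>i\<in>J - {Min J}. nz i)"
      using subsetD[OF s(2)] by (intro prod.cong coord_power_nz) force+
    ultimately show ?thesis using J by (simp add: prod.remove)
  qed
  have "eval_at x (f1_poly d j m) = 1 - (\<Sum>i=1..j-1. nz i)
      + (\<Sum>s=2..j-1. \<Sum>J | J \<subseteq> {1..j-1} \<and> card J = s. (- 1) ^ s * (\<Prod>i\<in>J. nz i))"
  proof -
    have "eval_at x (f1_poly d j m) = x j ^ (m * (d j - 1)) - (\<Sum>i=1..j-1. x i ^ (m * (d j - 1)))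
      + (\<Sum>s=2..j-1. \<Sum>J | J \<subseteq> {1..j-1} \<and> card J = s. (- 1) ^ s *
          (x (Min J) ^ (m * (d j - 1) - (\<Sum>i\<in>J - {Min J}. d i - 1))
            * (\<Prod>i\<in>J - {Min J}. x i ^ (d i - 1))))"
      by (simp add: f1_poly_def mult.assoc del: One_nat_def)
    also have "(\<Sum>s=2..j-1. \<Sum>J | J \<subseteq> {1..j-1} \<and> card J = s. (- 1) ^ s *
          (x (Min J) ^ (m * (d j - 1) - (\<Sum>i\<in>J - {Min J}. d i - 1))
            * (\<Prod>i\<in>J - {Min J}. x i ^ (d i - 1))))
        = (\<Sum>s=2..j-1. \<Sum>J | J \<subseteq> {1..j-1} \<and> card J = s. (- 1) ^ s * (\<Prod>i\<in>J. nz i))"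
      by (intro sum.cong refl arg_cong2[where f = "(*)"] term_eq) auto
    also have "(\<Sum>i=1..j-1. x i ^ (m * (d j - 1))) = (\<Sum>i=1..j-1. nz i)"
      using j by (intro sum.cong coord_power_nz) auto
    finally show ?thesis by (simp only: coord_power_mult[OF order.refl assms])
  qed
  also have "\<dots> = (\<Prod>i=1..j-1. 1 - nz i)"
    using prod_one_minus_by_card[of "{1..j-1}" nz] j by simp
  finally show ?thesis .
qed

text \<open>If \<open>x 0 = 0\<close>, the positive power of \<open>Var 0\<close> vanishes.
  Otherwise \<open>x 0\<close> is a unit in every field of the tower, so all its powers that occur
  are 1.\<close>

lemma eval_f2: "eval_at x (f2_poly d j m) = nz 0 * (\<Prod>i=1..j-1. 1 - nz i)"
proof (cases "x 0 = 0")
  case True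
  then show ?thesis using sum_less by (simp add: f2_poly_def)
next
  case False
  moreover have "(\<Prod>i=1..j-1. x 0 ^ (d i - 1) - x i ^ (d i - 1)) = (\<Prod>i=1..j-1. 1 - nz i)"
    using False j
    by (intro prod.cong arg_cong2[where f = minus] coord_power_card coord_power_nz) auto
  ultimately show ?thesis
    using coord_power_rest[of "{1..j-1}" 0] by (simp add: f2_poly_def)
qed

lemma eval_head_neq_0_iff:
  "eval_at x (Var j * (f1_poly d j m - f2_poly d j m)) \<noteq> 0 \<longleftrightarrow> x j \<noteq> 0 \<and> (\<forall>i<j. x i = 0)"
proof (cases "x j = 0")
  case False
  have split: "(\<forall>i<j. x i = 0) \<longleftrightarrow> x 0 = 0 \<and> (\<forall>i\<in>{1..j-1}. x i = 0)"
  proof -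
    have "{..<j} = insert 0 {1..j-1}" using j by auto
    then show ?thesis by (metis insert_iff lessThan_iff)
  qed
  \<comment> \<open>Subtracting \<open>f2_poly\<close> supplies the factor for index 0 that is
    absent from \<open>f1_poly\<close>.\<close>
  have "eval_at x (Var j * (f1_poly d j m - f2_poly d j m))
      = x j * ((1 - nz 0) * (\<Prod>i=1..j-1. 1 - nz i))"
    using False by (simp add: eval_f1 eval_f2 algebra_simps)
  then show ?thesis using False unfolding split by auto
qed simp

end

end

section \<open>The three kinds of leading index and the reduction to \<open>a j = 1\<close>\<close>

theorem proposition3p2:
  fixes n j :: nat
    and K :: "nat \<Rightarrow> 'k::{field,finite} set"
    and d m :: "nat \<Rightarrow> nat"
    and P :: "(nat \<Rightarrow> 'k) set"
    and a :: "nat \<Rightarrow> 'k"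
  assumes "n \<ge> 1"
    and "\<And>i. i \<le> n \<Longrightarrow> is_subfield (K i)"
    and "\<And>i. i < n \<Longrightarrow> K i \<subseteq> K (Suc i)"
    and "\<And>i. i \<le> n \<Longrightarrow> d i = card (K i)"
    and "\<And>i. 2 \<le> i \<Longrightarrow> i \<le> n \<Longrightarrow> m i = least_mult d i"
    and "P \<in> proj_grid n K"
    and "a \<in> P"
    and "\<And>i. i \<le> n \<Longrightarrow> a i \<in> K i"
    and "j = (LEAST i. i \<le> n \<and> a i \<noteq> 0)"
  shows "(j = 0 \<or> j = 1 \<longrightarrow>
           (\<exists>f. indicator_function n K P f \<and>
                total_degree f = 1 + (\<Sum>i=1..n. d i - 1)))
       \<and> (j \<ge> 2 \<longrightarrow>
           (\<exists>f. indicator_function n K P f \<and>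
                total_degree f = m j * (d j - 1) + 1 + (\<Sum>i=j+1..n. d i - 1)))
       \<and> (a j = 1 \<longrightarrow>
           (j = 0 \<longrightarrow>
             (let f = Var 0 * (\<Prod>i=1..n. \<Prod>c\<in>K i - {a i}. Var i - Const c * Var 0)
              in indicator_function n K P f \<and>
                 total_degree f = 1 + (\<Sum>i=1..n. d i - 1)))
         \<and> (j = 1 \<longrightarrow>
             (let f = Var 1 * (Var 1 ^ (d 1 - 1) - Var 0 ^ (d 1 - 1)) *
                      (\<Prod>i=2..n. \<Prod>c\<in>K i - {a i}. Var i - Const c * Var 1)
              in indicator_function n K P f \<and>
                 total_degree f = 1 + (\<Sum>i=1..n. d i - 1)))
         \<and> (j \<ge> 2 \<longrightarrow>
             (let f = Var j * (f1_poly d j (m j) - f2_poly d j (m j)) *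
                      (\<Prod>l=j+1..n. \<Prod>c\<in>K l - {a l}. Var l - Const c * Var j)
              in indicator_function n K P f \<and>
                 total_degree f = m j * (d j - 1) + 1 + (\<Sum>i=j+1..n. d i - 1))))"
proof -
  note subfield = assms(2) and card_K = assms(4)
  have tower: "K i \<subseteq> K k" if "i \<le> k" "k \<le> n" for i k
    using that
  proof (induction k rule: dec_induct)
    case (step k)
    then show ?case using assms(3)[of k] by auto
  qed simp
  have PS: "P \<in> proj_space n" using assms(6) by (simp add: proj_grid_def)
  have "\<exists>i. i \<le> n \<and> a i \<noteq> 0"
    using proj_space_nonzero_vectors[OF PS assms(7)] by (auto simp: nonzero_vectors_def)
  then have j: "j \<le> n" "a j \<noteq> 0" unfolding assms(9) by (metis (mono_tags, lifting) LeastI_ex)+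
  have low: "a i = 0" if "i < j" for i
    using not_less_Least[of i "\<lambda>i. i \<le> n \<and> a i \<noteq> 0"] that j unfolding assms(9)[symmetric] by auto
  let ?S = "\<lambda>k. \<Sum>i=k..n. d i - 1"
  have sum_card: "(\<Sum>i=k..n. card (K i) - 1) = ?S k" for k
    using card_K by (intro sum.cong) auto
  \<comment> \<open>For \<open>j = 1\<close> the head has degree \<open>1 + (d 1 - 1)\<close>, so
    the first summand of the degree belongs to the head and the tail starts at 2.\<close>
  have split_1: "1 + ?S 1 = Suc (d 1 - 1) + ?S 2"
    using assms(1) by (simp add: sum.atLeast_Suc_atMost numeral_2_eq_2)
  have d_ge_2: "d i \<ge> 2" if "i \<le> n" for i
    using that card_K subfield_card_ge_2[OF subfield] by simp
  have ind: "indicator_function n K P f \<and> total_degree f = e + ?S (j + 1)"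
    if "b \<in> P" "\<And>i. i \<le> n \<Longrightarrow> b i \<in> K i" "b j = 1" "\<And>i. i < j \<Longrightarrow> b i = 0" "form n e h"
      "\<And>x. (\<And>i. i \<le> n \<Longrightarrow> x i \<in> K i) \<Longrightarrow> eval_at x h \<noteq> 0 \<longleftrightarrow> x j \<noteq> 0 \<and> (\<forall>i<j. x i = 0)"
      "f = h * (\<Prod>i=j+1..n. \<Prod>c\<in>K i - {b i}. Var i - Const c * Var j)"
    for b e h f
    using indicator_of_head[OF subfield tower assms(6) that(1,2) j(1) that(3-7)] sum_card by simp
  \<comment> \<open>Formulated for any normalized representative \<open>b\<close>, since it serves
    both \<open>a\<close> itself when \<open>a j = 1\<close> and a rescaled \<open>a\<close>
    otherwise.\<close>
  have normalized:
    "(j = 0 \<longrightarrow>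
        (let f = Var 0 * (\<Prod>i=1..n. \<Prod>c\<in>K i - {b i}. Var i - Const c * Var 0)
         in indicator_function n K P f \<and> total_degree f = 1 + ?S 1))
     \<and> (j = 1 \<longrightarrow>
        (let f = Var 1 * (Var 1 ^ (d 1 - 1) - Var 0 ^ (d 1 - 1)) *
                 (\<Prod>i=2..n. \<Prod>c\<in>K i - {b i}. Var i - Const c * Var 1)
         in indicator_function n K P f \<and> total_degree f = 1 + ?S 1))
     \<and> (j \<ge> 2 \<longrightarrow>
        (let f = Var j * (f1_poly d j (m j) - f2_poly d j (m j)) *
                 (\<Prod>l=j+1..n. \<Prod>c\<in>K l - {b l}. Var l - Const c * Var j)
         in indicator_function n K P f \<and> total_degree f = m j * (d j - 1) + 1 + ?S (j + 1)))"
    if b: "b \<in> P" "\<And>i. i \<le> n \<Longrightarrow> b i \<in> K i" "b j = 1" "\<And>i. i < j \<Longrightarrow> b i = 0" for b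
  proof (intro conjI impI)
    assume "j = 0"
    then show "let f = Var 0 * (\<Prod>i=1..n. \<Prod>c\<in>K i - {b i}. Var i - Const c * Var 0)
         in indicator_function n K P f \<and> total_degree f = 1 + ?S 1"
      using ind[OF b form_Var[OF j(1)] _ refl] by (simp add: Let_def)
  next
    assume j1: "j = 1"
    let ?h = "Var 1 * (Var 1 ^ (d 1 - 1) - Var 0 ^ (d 1 - 1)) :: 'k mpolynomial"
    have h: "form n (1 + (d 1 - 1)) ?h"
      using assms(1) by (intro form_mult form_Var form_diff form_Var_power) auto
    have "eval_at x ?h \<noteq> 0 \<longleftrightarrow> x j \<noteq> 0 \<and> (\<forall>i<j. x i = 0)" if x: "\<And>i. i \<le> n \<Longrightarrow> x i \<in> K i" for x
    proof -
      \<comment> \<open>Both \<open>x 0\<close> and \<open>x 1\<close> lie in \<open>K 1\<close>. If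
        \<open>x 1\<close> is nonzero, the difference of powers is therefore 1 for
        \<open>x 0 = 0\<close> and 0 otherwise.\<close>
      have pow: "x i ^ (d 1 - 1) = 1" if "i \<le> 1" "x i \<noteq> 0" for i
        using that subfield_power_card[of "K 1" "x i"] subfield card_K x[of i] tower[of i 1] assms(1)
        by auto
      show ?thesis
        using pow[of 0] pow[of 1] d_ge_2[of 1] assms(1)
        by (cases "x 0 = 0"; cases "x 1 = 0") (auto simp: j1 power_0_left)
    qed
    from ind[OF b h this refl] show "let f = ?h * (\<Prod>i=2..n. \<Prod>c\<in>K i - {b i}. Var i - Const c * Var 1)
         in indicator_function n K P f \<and> total_degree f = 1 + ?S 1"
      unfolding split_1 by (simp add: Let_def j1 numeral_2_eq_2)
  next
    assume j2: "2 \<le> j"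
    interpret subfield_tower n j K d "m j"
      using subfield tower card_K j2 j assms(5) by unfold_locales auto
    let ?h = "Var j * (f1_poly d j (m j) - f2_poly d j (m j)) :: 'k mpolynomial"
    have h: "form n (1 + m j * (d j - 1)) ?h"
      using j by (intro form_mult form_Var form_diff form_f1 form_f2)
    from ind[OF b h eval_head_neq_0_iff refl]
    show "let f = ?h * (\<Prod>l=j+1..n. \<Prod>c\<in>K l - {b l}. Var l - Const c * Var j)
         in indicator_function n K P f \<and> total_degree f = m j * (d j - 1) + 1 + ?S (j + 1)"
      by (simp add: Let_def)
  qed
  \<comment> \<open>Division by \<open>a j\<close> keeps the entries in the fields: they are 0 below
    \<open>j\<close>, and from \<open>j\<close> on \<open>K i\<close> contains \<open>a j\<close>.
    The degree claims thus hold for every representative.\<close>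
  define b where "b = (\<lambda>i. inverse (a j) * a i)"
  have "b \<in> P" unfolding b_def using j by (intro proj_space_scale[OF PS assms(7)]) simp
  moreover have "b i \<in> K i" if "i \<le> n" for i
  proof (cases "i < j")
    case True
    then show ?thesis using subfield[OF that] low by (simp add: b_def is_subfield_def)
  next
    case False
    then have "a j \<in> K i" using tower[of j i] that assms(8)[OF j(1)] by auto
    then show ?thesis
      using subfield_divide[OF subfield[OF that] assms(8)[OF that]] by (simp add: b_def field_simps)
  qed
  moreover have "b j = 1" "\<And>i. i < j \<Longrightarrow> b i = 0" using j low by (auto simp: b_def)
  ultimately have *: "j = 0 \<or> j = 1 \<longrightarrow> (\<exists>f. indicator_function n K P f \<and> total_degree f = 1 + ?S 1)"
    "j \<ge> 2 \<longrightarrow> (\<exists>f. indicator_function n K P f \<and> total_degree f = m j * (d j - 1) + 1 + ?S (j + 1))"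
    using normalized[of b] unfolding Let_def by blast+
  from normalized[of a, OF assms(7,8) _ low] * show ?thesis by blast
qed

end
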